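(* Let $(X,\le,c)$ be a finite strongly involution poset and write $x^c=c(x)$, $Z^c=\{z^c:z\in Z\}$. (i) Let $A\in\mathcal{W}_+(X,\mathbf{2})$ and set $N(A)=\mathrm{Min}(A^{-1}(P))\cup\mathrm{Max}(A^{-1}(N))$ and $$\mathrm{Core}_{w_+}(A)=N(A)\setminus[\mathrm{Max}(A^{-1}(N))]^c.$$ Then $\mathrm{Core}_{w_+}(A)$ is the $\mathcal{W}_+(X,\mathbf{2})$-fundamental core for $A$. (ii) Let $A\in\mathcal{W}_-(X,\mathbf{2})$ and set $$\mathrm{Core}_{w_-}(A)=N(A)\setminus[\mathrm{Min}(A^{-1}(P))]^c.$$ Then $\mathrm{Core}_{w_-}(A)$ is the $\mathcal{W}_-(X,\mathbf{2})$-fundamental core for $A$.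
   Context: A strongly involution poset (SIP) is a poset $(X,\le)$ with a map $c:X\to X$ such that $c(c(x))=x$ for all $x$, $x\le y$ implies $c(y)\le c(x)$, and $c(x)\ne x$ for all $x$ (when $|X|\ge2$). $\mathbf{2}$ is the chain $N<P$. A boolean partial map (BPM) on $X$ is a map $A:\mathrm{dom}(A)\to\mathbf{2}$ with $\mathrm{dom}(A)\subseteq X$; it is total (BTM) if $\mathrm{dom}(A)=X$. $A$ is up-positive if $A^{-1}(P)$ is an up-set of $X$, down-negative if $A^{-1}(N)$ is a down-set of $X$, complemented positive if $A^{-1}(N)^c\subseteq A^{-1}(P)$, complemented negative if $A^{-1}(P)^c\subseteq A^{-1}(N)$. $\mathcal{W}_+(X,\mathbf{2})$ (resp. $\mathcal{W}_-(X,\mathbf{2})$) is the set of total boolean maps on $X$ that are up-positive, down-negative and complemented positive (resp. complemented negative). $\mathrm{Min}(Z)$, $\mathrm{Max}(Z)$ denote the sets of minimal/maximal elements of $Z$. For a family $\mathcal{H}$ of BTMs and $A\in\mathcal{H}$, a subset $W\subseteq X$ is an $\mathcal{H}$-core for $A$ if every $A'\in\mathcal{H}$ with $A'|_W=A|_W$ equals $A$; $W$ is the $\mathcal{H}$-fundamental core for $A$ if it is an $\mathcal{H}$-core for $A$ contained in every $\mathcal{H}$-core for $A$.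
   Formalization: The one-point poset, which the definition of strongly involution poset allows with c the identity, is excluded: there the empty set is already a core, while Core_{w+}(A) and Core_{w-}(A) are all of X, so both parts are false. *)

theory Defs
  imports Main
begin

text \<open>
  Posets are given by an explicit carrier \<open>X\<close> and an order \<open>le\<close> that is only constrained on \<open>X\<close>.
  For \<open>x \<in> X\<close>, the condition \<open>X \<noteq> {x}\<close> expresses $|X| \ge 2$; unlike \<open>card X \<ge> 2\<close> it is also
  correct for infinite \<open>X\<close>.
\<close>

locale strongly_involution_poset =
  fixes X :: "'a set" and le :: "'a \<Rightarrow> 'a \<Rightarrow> bool" and c :: "'a \<Rightarrow> 'a"
  assumes reflp: "reflp_on X le"
    and antisymp: "antisymp_on X le"
    and transp: "transp_on X le"
    and closed: "\<And>x. x \<in> X \<Longrightarrow> c x \<in> X"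
    and involution: "\<And>x. x \<in> X \<Longrightarrow> c (c x) = x"
    and antitone: "\<And>x y. x \<in> X \<Longrightarrow> y \<in> X \<Longrightarrow> le x y \<Longrightarrow> le (c y) (c x)"
    and no_fixpoint: "\<And>x. x \<in> X \<Longrightarrow> X \<noteq> {x} \<Longrightarrow> c x \<noteq> x"

definition up_set :: "'a set \<Rightarrow> ('a \<Rightarrow> 'a \<Rightarrow> bool) \<Rightarrow> 'a set \<Rightarrow> bool" where
  "up_set X le U \<longleftrightarrow> U \<subseteq> X \<and> (\<forall>x\<in>U. \<forall>y\<in>X. le x y \<longrightarrow> y \<in> U)"

definition down_set :: "'a set \<Rightarrow> ('a \<Rightarrow> 'a \<Rightarrow> bool) \<Rightarrow> 'a set \<Rightarrow> bool" where
  "down_set X le D \<longleftrightarrow> D \<subseteq> X \<and> (\<forall>x\<in>D. \<forall>y\<in>X. le y x \<longrightarrow> y \<in> D)"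

definition Minimals :: "('a \<Rightarrow> 'a \<Rightarrow> bool) \<Rightarrow> 'a set \<Rightarrow> 'a set" where
  "Minimals le Z = {z \<in> Z. \<forall>y\<in>Z. le y z \<longrightarrow> y = z}"

definition Maximals :: "('a \<Rightarrow> 'a \<Rightarrow> bool) \<Rightarrow> 'a set \<Rightarrow> 'a set" where
  "Maximals le Z = {z \<in> Z. \<forall>y\<in>Z. le z y \<longrightarrow> y = z}"

datatype two = Neg | Pos

instantiation two :: linorder
begin

definition less_eq_two :: "two \<Rightarrow> two \<Rightarrow> bool" where
  "less_eq_two a b \<longleftrightarrow> a = Neg \<or> b = Pos"

definition less_two :: "two \<Rightarrow> two \<Rightarrow> bool" where
  "less_two a b \<longleftrightarrow> a = Neg \<and> b = Pos"

instance
proof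
  fix a b d :: two
  show "a < b \<longleftrightarrow> a \<le> b \<and> \<not> b \<le> a"
    by (cases a; cases b; simp add: less_eq_two_def less_two_def)
  show "a \<le> a"
    by (cases a; simp add: less_eq_two_def)
  show "a \<le> d" if "a \<le> b" "b \<le> d"
    using that by (cases b; simp add: less_eq_two_def)
  show "a = b" if "a \<le> b" "b \<le> a"
    using that by (auto simp add: less_eq_two_def)
  show "a \<le> b \<or> b \<le> a"
    by (cases a; simp add: less_eq_two_def)
qed

end

text \<open>
  Boolean partial maps on \<open>X\<close> are maps \<open>A :: 'a \<rightharpoonup> two\<close> with \<open>dom A \<subseteq> X\<close>. As \<open>A\<close> is \<open>None\<close> outside
  its domain, equality of maps is equality in the intended sense, and \<open>A |` W\<close> is restriction to \<open>W\<close>.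
\<close>

definition boolean_partial_map :: "'a set \<Rightarrow> ('a \<rightharpoonup> two) \<Rightarrow> bool" where
  "boolean_partial_map X A \<longleftrightarrow> dom A \<subseteq> X"

definition boolean_total_map :: "'a set \<Rightarrow> ('a \<rightharpoonup> two) \<Rightarrow> bool" where
  "boolean_total_map X A \<longleftrightarrow> boolean_partial_map X A \<and> dom A = X"

definition pos_part :: "('a \<rightharpoonup> two) \<Rightarrow> 'a set" where
  "pos_part A = A -` {Some Pos}"

definition neg_part :: "('a \<rightharpoonup> two) \<Rightarrow> 'a set" where
  "neg_part A = A -` {Some Neg}"

definition up_positive :: "'a set \<Rightarrow> ('a \<Rightarrow> 'a \<Rightarrow> bool) \<Rightarrow> ('a \<rightharpoonup> two) \<Rightarrow> bool" where
  "up_positive X le A \<longleftrightarrow> up_set X le (pos_part A)"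

definition down_negative :: "'a set \<Rightarrow> ('a \<Rightarrow> 'a \<Rightarrow> bool) \<Rightarrow> ('a \<rightharpoonup> two) \<Rightarrow> bool" where
  "down_negative X le A \<longleftrightarrow> down_set X le (neg_part A)"

definition complemented_positive :: "('a \<Rightarrow> 'a) \<Rightarrow> ('a \<rightharpoonup> two) \<Rightarrow> bool" where
  "complemented_positive c A \<longleftrightarrow> c ` neg_part A \<subseteq> pos_part A"

definition complemented_negative :: "('a \<Rightarrow> 'a) \<Rightarrow> ('a \<rightharpoonup> two) \<Rightarrow> bool" where
  "complemented_negative c A \<longleftrightarrow> c ` pos_part A \<subseteq> neg_part A"

definition W_plus :: "'a set \<Rightarrow> ('a \<Rightarrow> 'a \<Rightarrow> bool) \<Rightarrow> ('a \<Rightarrow> 'a) \<Rightarrow> ('a \<rightharpoonup> two) set" where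
  "W_plus X le c = {A. boolean_total_map X A \<and> up_positive X le A \<and> down_negative X le A
     \<and> complemented_positive c A}"

definition W_minus :: "'a set \<Rightarrow> ('a \<Rightarrow> 'a \<Rightarrow> bool) \<Rightarrow> ('a \<Rightarrow> 'a) \<Rightarrow> ('a \<rightharpoonup> two) set" where
  "W_minus X le c = {A. boolean_total_map X A \<and> up_positive X le A \<and> down_negative X le A
     \<and> complemented_negative c A}"

definition is_core :: "'a set \<Rightarrow> ('a \<rightharpoonup> two) set \<Rightarrow> ('a \<rightharpoonup> two) \<Rightarrow> 'a set \<Rightarrow> bool" where
  "is_core X H A W \<longleftrightarrow> W \<subseteq> X \<and> (\<forall>A'\<in>H. A' |` W = A |` W \<longrightarrow> A' = A)"

definition is_fundamental_core :: "'a set \<Rightarrow> ('a \<rightharpoonup> two) set \<Rightarrow> ('a \<rightharpoonup> two) \<Rightarrow> 'a set \<Rightarrow> bool" where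
  "is_fundamental_core X H A W \<longleftrightarrow> is_core X H A W \<and> (\<forall>V. is_core X H A V \<longrightarrow> W \<subseteq> V)"

definition N_set :: "('a \<Rightarrow> 'a \<Rightarrow> bool) \<Rightarrow> ('a \<rightharpoonup> two) \<Rightarrow> 'a set" where
  "N_set le A = Minimals le (pos_part A) \<union> Maximals le (neg_part A)"

definition Core_w_plus :: "('a \<Rightarrow> 'a \<Rightarrow> bool) \<Rightarrow> ('a \<Rightarrow> 'a) \<Rightarrow> ('a \<rightharpoonup> two) \<Rightarrow> 'a set" where
  "Core_w_plus le c A = N_set le A - c ` Maximals le (neg_part A)"

definition Core_w_minus :: "('a \<Rightarrow> 'a \<Rightarrow> bool) \<Rightarrow> ('a \<Rightarrow> 'a) \<Rightarrow> ('a \<rightharpoonup> two) \<Rightarrow> 'a set" where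
  "Core_w_minus le c A = N_set le A - c ` Minimals le (pos_part A)"

text \<open>
  The definition of a strongly involution poset admits the one-point poset with \<open>c x = x\<close>. There
  \<open>W_plus\<close> consists of a single map, whose fundamental core is empty, while \<open>Core_w_plus\<close> of
  that map is the whole poset. The theorem therefore has to assume \<open>card X \<noteq> 1\<close>.
\<close>

lemma singleton_counterexample:
  fixes x :: 'a
  defines "A \<equiv> [x \<mapsto> Pos]"
  shows "strongly_involution_poset {x} (=) id"
    and "A \<in> W_plus {x} (=) id"
    and "\<not> is_fundamental_core {x} (W_plus {x} (=) id) A (Core_w_plus (=) id A)"
proof -
  show "strongly_involution_poset {x} (=) id"
    by unfold_locales (auto simp: reflp_on_def antisymp_on_def transp_on_def)
  have pos: "pos_part A = {x}" and neg: "neg_part A = {}"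
    by (auto simp: A_def pos_part_def neg_part_def split: if_splits)
  show "A \<in> W_plus {x} (=) id"
    using pos neg
    by (auto simp: W_plus_def boolean_total_map_def boolean_partial_map_def up_positive_def
        down_negative_def complemented_positive_def up_set_def down_set_def A_def)
  have "A' = A" if A': "A' \<in> W_plus {x} (=) id" for A'
  proof -
    from A' have d: "dom A' = {x}" and cp: "neg_part A' \<subseteq> pos_part A'"
      by (auto simp: W_plus_def boolean_total_map_def complemented_positive_def)
    from d obtain s where s: "A' x = Some s" by auto
    have "s = Pos"
      using cp s by (cases s) (auto simp: neg_part_def pos_part_def)
    with s d show ?thesis
      by (auto simp: A_def fun_eq_iff dom_def)
  qed
  then have "is_core {x} (W_plus {x} (=) id) A {}"
    by (auto simp: is_core_def)
  moreover have "Core_w_plus (=) id A = {x}"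
    by (auto simp: Core_w_plus_def N_set_def pos neg Minimals_def Maximals_def)
  ultimately show "\<not> is_fundamental_core {x} (W_plus {x} (=) id) A (Core_w_plus (=) id A)"
    by (auto simp: is_fundamental_core_def)
qed

end

theory Submission
  imports Defs
begin

text \<open>
  A map in \<open>W_plus\<close> is recovered from its maximal negative elements together with its minimal
  positive ones, and a minimal positive element of the form \<open>c m\<close> with \<open>m\<close> maximal negative is
  forced to be positive by \<open>m\<close> alone, so it may be omitted. Every other extremal element can be
  flipped without leaving \<open>W_plus\<close>, hence it lies in every core. The case of \<open>W_minus\<close> is dual:
  reversing the order of \<open>X\<close> and exchanging the two values maps \<open>W_minus\<close> onto \<open>W_plus\<close>.
\<close>

text \<open>Minimality is sought only among the elements of \<open>Z\<close> below \<open>x\<close>: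
  this set is finite and contains \<open>x\<close>, and by transitivity anything in \<open>Z\<close>
  below one of its members belongs to it again, so an element minimal there is minimal in
  \<open>Z\<close>.\<close>

lemma Minimals_below:
  assumes "finite Z" "reflp_on Z le" "transp_on Z le" "antisymp_on Z le" "x \<in> Z"
  shows "\<exists>m \<in> Minimals le Z. le m x"
proof -
  let ?R = "\<lambda>a b. le a b \<and> a \<noteq> b" and ?L = "{y \<in> Z. le y x}"
  have trans: "le a d" if "a \<in> Z" "b \<in> Z" "d \<in> Z" "le a b" "le b d" for a b d
    using assms(3) that by (auto dest: transp_onD)
  have anti: "a = b" if "a \<in> Z" "b \<in> Z" "le a b" "le b a" for a b
    using assms(4) that by (auto dest: antisymp_onD)
  have "finite ?L" "?L \<noteq> {}"
    using assms(1,2,5) by (auto dest: reflp_onD)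
  moreover have "transp_on ?L ?R"
    by (rule transp_onI) (use trans anti in blast)
  moreover have "asymp_on ?L ?R"
    by (rule asymp_onI) (use anti in blast)
  ultimately obtain m where m: "m \<in> ?L" "\<forall>y\<in>?L. y \<noteq> m \<longrightarrow> \<not> ?R y m"
    using Finite_Set.bex_min_element[of ?L ?R] by blast
  have "y = m" if "y \<in> Z" "le y m" for y
    using trans[of y m x] m that assms(5) by blast
  then show ?thesis
    using m(1) by (auto simp: Minimals_def)
qed

lemma Minimals_conversep: "Minimals le\<inverse>\<inverse> = Maximals le"
  by (simp add: Minimals_def Maximals_def fun_eq_iff)

lemma Maximals_conversep: "Maximals le\<inverse>\<inverse> = Minimals le"
  by (simp add: Minimals_def Maximals_def fun_eq_iff)

lemma Maximals_above:
  assumes "finite Z" "reflp_on Z le" "transp_on Z le" "antisymp_on Z le" "x \<in> Z"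
  shows "\<exists>m \<in> Maximals le Z. le x m"
  using Minimals_below[of Z "le\<inverse>\<inverse>" x] assms by (simp add: Minimals_conversep)

lemma mem_pos_part_iff: "x \<in> pos_part A \<longleftrightarrow> A x = Some Pos"
  by (simp add: pos_part_def)

lemma mem_neg_part_iff: "x \<in> neg_part A \<longleftrightarrow> A x = Some Neg"
  by (simp add: neg_part_def)

lemma boolean_total_map_iff:
  "boolean_total_map X A \<longleftrightarrow> pos_part A \<union> neg_part A = X"
proof -
  have "dom A = pos_part A \<union> neg_part A"
    using two.exhaust by (auto simp: pos_part_def neg_part_def)
  then show ?thesis
    by (auto simp: boolean_total_map_def boolean_partial_map_def)
qed

lemma pos_part_inter_neg_part: "pos_part A \<inter> neg_part A = {}"
  by (auto simp: pos_part_def neg_part_def)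

lemma restrict_map_eq_iff: "A |` W = B |` W \<longleftrightarrow> (\<forall>x\<in>W. A x = B x)"
  by (auto simp: fun_eq_iff restrict_map_def)

text \<open>A change at the single point \<open>x\<close> is invisible on any set avoiding
  \<open>x\<close>. This is how points are forced into every core.\<close>

lemma is_core_updD:
  assumes "is_core X H A V" "A(x := b) \<in> H" "A x \<noteq> b"
  shows "x \<in> V"
  using assms unfolding is_core_def restrict_map_eq_iff by (metis fun_upd_apply)

text \<open>Positive and negative part are complementary in \<open>X\<close>, so up-positivity and
  down-negativity are one and the same closure condition.\<close>

lemma mem_W_plus_iff:
  "A \<in> W_plus X le c \<longleftrightarrow> pos_part A \<union> neg_part A = X \<and>
     (\<forall>x\<in>X. \<forall>y\<in>X. le x y \<longrightarrow> y \<in> neg_part A \<longrightarrow> x \<in> neg_part A) \<and>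
     c ` neg_part A \<subseteq> pos_part A"
  using pos_part_inter_neg_part[of A]
  unfolding W_plus_def boolean_total_map_iff up_positive_def down_negative_def up_set_def
    down_set_def complemented_positive_def
  by blast

context strongly_involution_poset
begin

lemma is_core_Core_w_plus:
  assumes "finite X" "A \<in> W_plus X le c"
  shows "is_core X (W_plus X le c) A (Core_w_plus le c A)"
  unfolding is_core_def
proof (intro conjI ballI impI)
  let ?P = "pos_part A" and ?N = "neg_part A"
  have A: "?P \<union> ?N = X" "c ` ?N \<subseteq> ?P" and disj: "?P \<inter> ?N = {}"
    using assms(2) pos_part_inter_neg_part[of A] by (auto simp: mem_W_plus_iff)
  have max: "Maximals le ?N \<subseteq> ?N" and min: "Minimals le ?P \<subseteq> ?P"
    by (auto simp: Maximals_def Minimals_def)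
  show "Core_w_plus le c A \<subseteq> X"
    using max min A(1) by (auto simp: Core_w_plus_def N_set_def)
  fix A' assume "A' \<in> W_plus X le c" and eq: "A' |` Core_w_plus le c A = A |` Core_w_plus le c A"
  let ?P' = "pos_part A'" and ?N' = "neg_part A'"
  have A': "?P' \<union> ?N' = X" "c ` ?N' \<subseteq> ?P'"
      "\<And>x y. x \<in> X \<Longrightarrow> y \<in> X \<Longrightarrow> le x y \<Longrightarrow> y \<in> ?N' \<Longrightarrow> x \<in> ?N'" and disj': "?P' \<inter> ?N' = {}"
    using \<open>A' \<in> W_plus X le c\<close> pos_part_inter_neg_part[of A'] by (auto simp: mem_W_plus_iff)
  have ord: "reflp_on Z le" "transp_on Z le" "antisymp_on Z le" "finite Z" if "Z \<subseteq> X" for Z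
    using that reflp transp antisymp assms(1)
    by (auto intro: reflp_on_subset transp_on_subset antisymp_on_subset finite_subset)
  have "Maximals le ?N \<subseteq> Core_w_plus le c A"
    using max A(2) disj by (auto simp: Core_w_plus_def N_set_def)
  then have maxN': "Maximals le ?N \<subseteq> ?N'"
    using max eq by (auto simp: restrict_map_eq_iff mem_neg_part_iff subset_iff)
  have N: "?N \<subseteq> ?N'"
  proof
    fix x assume x: "x \<in> ?N"
    then obtain m where "m \<in> Maximals le ?N" "le x m"
      using Maximals_above[of ?N le x] ord[of ?N] A(1) by blast
    then show "x \<in> ?N'"
      using A'(3)[of x m] maxN' max x A(1) by blast
  qed
  have "Minimals le ?P \<subseteq> Core_w_plus le c A \<union> c ` Maximals le ?N"
    by (auto simp: Core_w_plus_def N_set_def)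
  \<comment> \<open>The omitted points are images of points already known to be negative under
    \<open>A'\<close>, which is complemented positive.\<close>
  moreover have "c ` Maximals le ?N \<subseteq> ?P'"
    using maxN' A'(2) by blast
  moreover have "Core_w_plus le c A \<inter> ?P \<subseteq> ?P'"
    using eq by (auto simp: restrict_map_eq_iff mem_pos_part_iff)
  ultimately have minP': "Minimals le ?P \<subseteq> ?P'"
    using min by blast
  have P: "?P \<subseteq> ?P'"
  proof
    fix x assume x: "x \<in> ?P"
    then obtain m where "m \<in> Minimals le ?P" "le m x"
      using Minimals_below[of ?P le x] ord[of ?P] A(1) by blast
    \<comment> \<open>If \<open>x\<close> were negative under \<open>A'\<close>, so would be
      \<open>m\<close> below it.\<close>
    then show "x \<in> ?P'"
      using A'(1) A'(3)[of m x] minP' min disj' x A(1) by blast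
  qed
  show "A' = A"
  proof
    fix x
    show "A' x = A x"
    proof (cases "x \<in> X")
      case True
      then show ?thesis
        using N P A(1) by (auto simp: mem_pos_part_iff mem_neg_part_iff subset_iff)
    next
      case False
      then have "x \<notin> ?P \<union> ?N" "x \<notin> ?P' \<union> ?N'"
        using A(1) A'(1) by auto
      then have "A x = None" "A' x = None"
        by (metis UnCI mem_neg_part_iff mem_pos_part_iff option.exhaust two.exhaust)+
      then show ?thesis by simp
    qed
  qed
qed

lemma Core_w_plus_subset_core:
  assumes "card X \<noteq> 1" "A \<in> W_plus X le c" "is_core X (W_plus X le c) A V"
  shows "Core_w_plus le c A \<subseteq> V"
proof
  let ?P = "pos_part A" and ?N = "neg_part A"
  have A: "?P \<union> ?N = X" "c ` ?N \<subseteq> ?P"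
      "\<And>x y. x \<in> X \<Longrightarrow> y \<in> X \<Longrightarrow> le x y \<Longrightarrow> y \<in> ?N \<Longrightarrow> x \<in> ?N" and disj: "?P \<inter> ?N = {}"
    using assms(2) pos_part_inter_neg_part[of A] by (auto simp: mem_W_plus_iff)
  fix x assume "x \<in> Core_w_plus le c A"
  then consider "x \<in> Maximals le ?N" | "x \<in> Minimals le ?P" "x \<notin> c ` Maximals le ?N"
    by (auto simp: Core_w_plus_def N_set_def)
  then show "x \<in> V"
  proof cases
    case 1
    let ?B = "A(x \<mapsto> Pos)"
    have x: "x \<in> ?N" "\<And>y. y \<in> ?N \<Longrightarrow> le x y \<Longrightarrow> y = x"
      using 1 by (auto simp: Maximals_def)
    have B: "pos_part ?B = insert x ?P" "neg_part ?B = ?N - {x}"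
      by (auto simp: mem_pos_part_iff mem_neg_part_iff split: if_splits)
    \<comment> \<open>Maximality keeps the smaller negative part a down-set, and shrinking it while
      enlarging the positive part preserves complemented positivity.\<close>
    have "?B \<in> W_plus X le c"
      unfolding mem_W_plus_iff B using A x by blast
    then show ?thesis
      using is_core_updD[OF assms(3)] x(1) by (auto simp: mem_neg_part_iff)
  next
    case 2
    let ?B = "A(x \<mapsto> Neg)"
    have x: "x \<in> ?P" "\<And>y. y \<in> ?P \<Longrightarrow> le y x \<Longrightarrow> y = x"
      using 2 by (auto simp: Minimals_def)
    then have "x \<in> X"
      using A(1) by blast
    have B: "pos_part ?B = ?P - {x}" "neg_part ?B = insert x ?N"
      by (auto simp: mem_pos_part_iff mem_neg_part_iff split: if_splits)
    \<comment> \<open>A negative \<open>c x\<close> would be maximal: for a negative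
      \<open>y\<close> above it, \<open>c y\<close> is positive and below \<open>x\<close>, so
      \<open>c y = x\<close> by minimality and \<open>y = c x\<close>. Then
      \<open>x = c (c x)\<close> would be one of the omitted points.\<close>
    have "c x \<notin> ?N"
    proof
      assume cx: "c x \<in> ?N"
      have "y = c x" if y: "y \<in> ?N" "le (c x) y" for y
        using x(2)[of "c y"] antitone[of "c x" y] involution[of x] involution[of y] y cx A(1,2)
          \<open>x \<in> X\<close> by auto
      with cx have "c x \<in> Maximals le ?N"
        by (simp add: Maximals_def)
      then show False
        using 2(2) involution[OF \<open>x \<in> X\<close>] by (metis imageI)
    qed
    \<comment> \<open>At a fixed point of \<open>c\<close>, the new negative value would violate
      complemented positivity; \<open>card X \<noteq> 1\<close> rules this out.\<close>
    moreover have "c x \<noteq> x"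
      using no_fixpoint[OF \<open>x \<in> X\<close>] assms(1) by (metis is_singletonI is_singleton_altdef)
    moreover have "x \<notin> c ` ?N"
      using \<open>c x \<notin> ?N\<close> involution A(1) by auto
    ultimately have "c ` insert x ?N \<subseteq> ?P - {x}"
      using closed[OF \<open>x \<in> X\<close>] A(1,2) by auto
    then have "?B \<in> W_plus X le c"
      unfolding mem_W_plus_iff B using A(1,3) x disj by blast
    then show ?thesis
      using is_core_updD[OF assms(3)] x(1) by (auto simp: mem_pos_part_iff)
  qed
qed

lemma is_fundamental_core_Core_w_plus:
  assumes "finite X" "card X \<noteq> 1" "A \<in> W_plus X le c"
  shows "is_fundamental_core X (W_plus X le c) A (Core_w_plus le c A)"
  using assms is_core_Core_w_plus Core_w_plus_subset_core
  by (auto simp: is_fundamental_core_def)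

lemma dual_strongly_involution_poset: "strongly_involution_poset X le\<inverse>\<inverse> c"
  using reflp transp antisymp closed involution antitone no_fixpoint
  by unfold_locales auto

end

fun flip :: "two \<Rightarrow> two" where
  "flip Neg = Pos"
| "flip Pos = Neg"

lemma flip_flip [simp]: "flip (flip a) = a"
  by (cases a) auto

text \<open>Exchanging values turns the positive up-set into a negative up-set, hence a down-set for
  the reversed order; this is why \<open>flip_map\<close> is paired with
  \<open>le\<inverse>\<inverse>\<close> below.\<close>

definition flip_map :: "('a \<rightharpoonup> two) \<Rightarrow> ('a \<rightharpoonup> two)" where
  "flip_map A = map_option flip \<circ> A"

lemma flip_map_flip_map [simp]: "flip_map (flip_map A) = A"
  by (simp add: flip_map_def fun_eq_iff option.map_comp comp_def option.map_ident)

lemma flip_map_eq_iff [simp]: "flip_map A = flip_map B \<longleftrightarrow> A = B"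
  by (metis flip_map_flip_map)

lemma flip_eq_iff: "flip a = b \<longleftrightarrow> a = flip b"
  by (cases a; cases b) auto

lemma pos_part_flip_map [simp]: "pos_part (flip_map A) = neg_part A"
  by (auto simp: flip_map_def pos_part_def neg_part_def flip_eq_iff)

lemma neg_part_flip_map [simp]: "neg_part (flip_map A) = pos_part A"
  by (auto simp: flip_map_def pos_part_def neg_part_def flip_eq_iff)

lemma restrict_flip_map: "flip_map A |` W = flip_map (A |` W)"
  by (auto simp: flip_map_def restrict_map_def fun_eq_iff)

lemma flip_map_in_W_plus_iff: "flip_map A \<in> W_plus X le\<inverse>\<inverse> c \<longleftrightarrow> A \<in> W_minus X le c"
  by (auto simp: W_plus_def W_minus_def boolean_total_map_iff up_positive_def down_negative_def
      up_set_def down_set_def complemented_positive_def complemented_negative_def)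

text \<open>Two swaps, of the parts and of minimal with maximal, leave \<open>N_set\<close>
  unchanged and turn the removed maximal negative points into minimal positive ones.\<close>

lemma Core_w_plus_flip_map: "Core_w_plus le\<inverse>\<inverse> c (flip_map A) = Core_w_minus le c A"
  by (auto simp: Core_w_plus_def Core_w_minus_def N_set_def Minimals_conversep Maximals_conversep)

text \<open>\<open>flip_map\<close> is a bijection between the two families that commutes with
  restriction, so it preserves cores.\<close>

lemma is_core_flip_map_iff:
  "is_core X (W_plus X le\<inverse>\<inverse> c) (flip_map A) W \<longleftrightarrow> is_core X (W_minus X le c) A W"
proof -
  have "(\<forall>B \<in> W_plus X le\<inverse>\<inverse> c. Q B) \<longleftrightarrow> (\<forall>B \<in> W_minus X le c. Q (flip_map B))" for Q
    by (metis flip_map_in_W_plus_iff flip_map_flip_map)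
  then show ?thesis
    by (simp add: is_core_def restrict_flip_map)
qed

theorem theorem3p11:
  fixes X :: "'a set" and le :: "'a \<Rightarrow> 'a \<Rightarrow> bool" and c :: "'a \<Rightarrow> 'a"
  assumes "strongly_involution_poset X le c"
    and "finite X"
    and "card X \<noteq> 1"
  shows "(\<forall>A \<in> W_plus X le c. is_fundamental_core X (W_plus X le c) A (Core_w_plus le c A)) \<and>
    (\<forall>A \<in> W_minus X le c. is_fundamental_core X (W_minus X le c) A (Core_w_minus le c A))"
proof (intro conjI ballI)
  interpret strongly_involution_poset X le c by fact
  interpret dual: strongly_involution_poset X "le\<inverse>\<inverse>" c
    by (rule dual_strongly_involution_poset)
  show "is_fundamental_core X (W_plus X le c) A (Core_w_plus le c A)"
    if "A \<in> W_plus X le c" for A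
    using that assms(2,3) by (intro is_fundamental_core_Core_w_plus)
  show "is_fundamental_core X (W_minus X le c) A (Core_w_minus le c A)"
    if "A \<in> W_minus X le c" for A
    using dual.is_fundamental_core_Core_w_plus[of "flip_map A"] that assms(2,3)
    by (simp add: is_fundamental_core_def is_core_flip_map_iff Core_w_plus_flip_map
        flip_map_in_W_plus_iff)
qed

end
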